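(* There are exactly $16$ equational classes of Boolean functions contained in $\Omega(1)$, i.e. the interval $[\emptyset,\Omega(1)]$ of ${\bf E}_{\mathbb{B}}$ has exactly $16$ elements.
   Context: $\mathbb{B}=\{0,1\}$; a Boolean function is a map $\mathbb{B}^n\to\mathbb{B}$, $n\ge1$. For an $m$-ary $g$ and $n$-ary $f$, $g\preceq_{\bf V}f$ means $g=f(p_1,\dots,p_n)$ for some $m$-ary projections $p_i$. An equational class of Boolean functions is a set of Boolean functions closed under this operation (if $f$ is in the class and $g\preceq_{\bf V}f$ then $g$ is in the class); ${\bf E}_{\mathbb{B}}$ is the set of all such classes (including $\emptyset$). $\Omega(1)$ is the class of all quasi-monadic Boolean functions (those with at most one essential variable): projections, negated projections and constant functions of all arities. *)

theory Defs
  imports Main "HOL-Library.FuncSet"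
begin

definition cube :: "nat \<Rightarrow> (nat \<Rightarrow> bool) set" where
  "cube n = {..<n} \<rightarrow>\<^sub>E UNIV"

text \<open>
  A Boolean function is a pair of its arity \<open>n \<ge> 1\<close> and a map on \<open>cube n\<close>. The map is extensional,
  i.e. takes a fixed dummy value off the cube, so that equality of pairs is equality of Boolean
  functions. Variables are numbered from 0.
\<close>

type_synonym bfun = "nat \<times> ((nat \<Rightarrow> bool) \<Rightarrow> bool)"

definition boolean_functions :: "bfun set" where
  "boolean_functions = (SIGMA n:{1..}. cube n \<rightarrow>\<^sub>E UNIV)"

definition projection :: "nat \<Rightarrow> nat \<Rightarrow> (nat \<Rightarrow> bool) \<Rightarrow> bool" where
  "projection m i = (\<lambda>x\<in>cube m. x i)"

definition projections :: "nat \<Rightarrow> ((nat \<Rightarrow> bool) \<Rightarrow> bool) set" where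
  "projections m = projection m ` {..<m}"

text \<open>The \<open>m\<close>-ary function \<open>f(h\<^sub>0, \<dots>, h\<^sub>n\<^sub>-\<^sub>1)\<close>, for \<open>n\<close>-ary \<open>f\<close> and \<open>m\<close>-ary \<open>h\<^sub>j\<close>.\<close>

definition bcompose ::
  "nat \<Rightarrow> nat \<Rightarrow> ((nat \<Rightarrow> bool) \<Rightarrow> bool) \<Rightarrow> (nat \<Rightarrow> (nat \<Rightarrow> bool) \<Rightarrow> bool) \<Rightarrow> (nat \<Rightarrow> bool) \<Rightarrow> bool"
  where
  "bcompose m n f h = (\<lambda>x\<in>cube m. f (\<lambda>j\<in>{..<n}. h j x))"

definition preceq_V :: "bfun \<Rightarrow> bfun \<Rightarrow> bool"  (infix "\<preceq>\<^sub>V" 50) where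
  "g \<preceq>\<^sub>V f \<longleftrightarrow>
     g \<in> boolean_functions \<and> f \<in> boolean_functions \<and>
     (\<exists>p. (\<forall>j<fst f. p j \<in> projections (fst g)) \<and>
          snd g = bcompose (fst g) (fst f) (snd f) p)"

definition equational_class :: "bfun set \<Rightarrow> bool" where
  "equational_class K \<longleftrightarrow>
     K \<subseteq> boolean_functions \<and> (\<forall>f g. f \<in> K \<and> g \<preceq>\<^sub>V f \<longrightarrow> g \<in> K)"

definition E_B :: "bfun set set" where
  "E_B = {K. equational_class K}"

definition essential_variables :: "bfun \<Rightarrow> nat set" where
  "essential_variables f =
     {i. i < fst f \<and> (\<exists>x\<in>cube (fst f). \<exists>b. snd f (x(i := b)) \<noteq> snd f x)}"

definition Omega1 :: "bfun set" where
  "Omega1 = {f \<in> boolean_functions. card (essential_variables f) \<le> 1}"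

end

theory Submission
  imports Defs "HOL-Library.Cardinality"
begin

text \<open>
  A quasi-monadic function has the form \<open>x \<mapsto> \<phi> (x i)\<close> with \<open>\<phi> : \<bool> \<rightarrow> \<bool>\<close>. Identifying or permuting
  variables and adding dummy ones changes the arity and \<open>i\<close> arbitrarily but never \<open>\<phi>\<close>, which is
  recovered as the restriction to the diagonal. So the classes below \<open>Omega1\<close> correspond to the
  sets of maps \<open>\<phi>\<close>, and there are \<open>2 ^ 4\<close> of those.
\<close>

definition lift_unary :: "nat \<Rightarrow> nat \<Rightarrow> (bool \<Rightarrow> bool) \<Rightarrow> bfun" where
  "lift_unary n i \<phi> = (n, \<lambda>x\<in>cube n. \<phi> (x i))"

definition diagonal :: "bfun \<Rightarrow> bool \<Rightarrow> bool" where
  "diagonal f b = snd f (\<lambda>j\<in>{..<fst f}. b)"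

lemma const_in_cube: "(\<lambda>j\<in>{..<n}. b) \<in> cube n"
  by (auto simp: cube_def)

lemma fun_upd_in_cube: "x \<in> cube n \<Longrightarrow> i < n \<Longrightarrow> x(i := b) \<in> cube n"
  by (auto simp: cube_def PiE_def extensional_def)

lemma diagonal_lift_unary: "i < n \<Longrightarrow> diagonal (lift_unary n i \<phi>) = \<phi>"
  by (auto simp: diagonal_def lift_unary_def const_in_cube)

text \<open>Replace the coordinates of \<open>x\<close> by those of \<open>y\<close> one at a time.
  At an essential variable the replacement changes nothing, because the two values agree; at any
  other it cannot change the value of \<open>f\<close>.\<close>

lemma eq_on_if_agree_on_essential:
  assumes x: "x \<in> cube (fst f)" and y: "y \<in> cube (fst f)"
    and agree: "\<And>i. i \<in> essential_variables f \<Longrightarrow> x i = y i"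
  shows "snd f x = snd f y"
proof -
  let ?n = "fst f"
  \<comment> \<open>The intermediate points take their values from \<open>y\<close> on
    \<open>A\<close> and from \<open>x\<close> elsewhere. They stay in the cube because
    \<open>x\<close> and \<open>y\<close> are both undefined off \<open>{..<?n}\<close>.\<close>
  have mix: "override_on x y A \<in> cube ?n" for A
    using x y by (auto simp: cube_def PiE_def extensional_def override_on_def)
  have "A \<subseteq> {..<?n} \<Longrightarrow> snd f (override_on x y A) = snd f x" if "finite A" for A
    using that
  proof induction
    case (insert a A)
    show ?case
    proof (cases "a \<in> essential_variables f")
      case True
      then show ?thesis
        using insert agree[OF True]
        by (simp add: override_on_insert override_on_apply_notin fun_upd_idem)
    next
      case False
      then have "snd f ((override_on x y A)(a := y a)) = snd f (override_on x y A)"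
        using mix[of A] insert.prems unfolding essential_variables_def by blast
      then show ?thesis
        using insert.IH insert.prems by (metis insert_subset override_on_insert)
    qed
  qed simp
  moreover have "override_on x y {..<?n} = y"
    using x y by (auto simp: cube_def PiE_def extensional_def override_on_def fun_eq_iff)
  ultimately show ?thesis
    by (metis finite_lessThan order_refl)
qed

lemma Omega1_iff_lift_unary:
  "f \<in> Omega1 \<longleftrightarrow> (\<exists>n i \<phi>. i < n \<and> f = lift_unary n i \<phi>)"
proof
  assume f: "f \<in> Omega1"
  let ?n = "fst f"
  have n: "0 < ?n" and ext: "snd f \<in> cube ?n \<rightarrow>\<^sub>E UNIV"
    using f by (auto simp: Omega1_def boolean_functions_def)
  have ess: "essential_variables f \<subseteq> {..<?n}"
    by (auto simp: essential_variables_def)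
  then have "finite (essential_variables f)"
    by (rule finite_subset) simp
  moreover have "card (essential_variables f) \<le> Suc 0"
    using f by (simp add: Omega1_def)
  ultimately have unique: "\<forall>j\<in>essential_variables f. \<forall>k\<in>essential_variables f. j = k"
    by (simp add: card_le_Suc0_iff_eq)
  \<comment> \<open>If no variable is essential, any index serves; one exists because arities are
    positive.\<close>
  obtain i where i: "i < ?n" "essential_variables f \<subseteq> {i}"
  proof (cases "essential_variables f = {}")
    case True
    then show ?thesis
      using that n by blast
  next
    case False
    then show ?thesis
      using that ess unique by blast
  qed
  \<comment> \<open>The point \<open>x\<close> and the constant tuple with value \<open>x i\<close>
    agree at \<open>i\<close>, the only variable that can be essential.\<close>
  have "snd f x = diagonal f (x i)" if "x \<in> cube ?n" for x
    unfolding diagonal_def using i that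
    by (intro eq_on_if_agree_on_essential const_in_cube) auto
  then have "f = lift_unary ?n i (diagonal f)"
    using ext by (auto simp: lift_unary_def prod_eq_iff fun_eq_iff PiE_def extensional_def)
  then show "\<exists>n i \<phi>. i < n \<and> f = lift_unary n i \<phi>"
    using i(1) by blast
next
  assume "\<exists>n i \<phi>. i < n \<and> f = lift_unary n i \<phi>"
  then obtain n i \<phi> where i: "i < n" and f: "f = lift_unary n i \<phi>"
    by blast
  \<comment> \<open>Only an inclusion, since a constant \<open>\<phi>\<close> leaves no essential
    variable.\<close>
  have "essential_variables f \<subseteq> {i}"
    by (auto simp: f essential_variables_def lift_unary_def fun_upd_in_cube split: if_splits)
  then have "card (essential_variables f) \<le> 1"
    using card_mono[of "{i}"] by fastforce
  then show "f \<in> Omega1"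
    using i by (auto simp: Omega1_def boolean_functions_def f lift_unary_def)
qed

text \<open>A projection sends the constant tuple with value \<open>b\<close> to \<open>b\<close>,
  so substituting projections carries constant tuples to constant tuples of the same value.\<close>

lemma preceq_V_diagonal_eq:
  assumes "g \<preceq>\<^sub>V f"
  shows "diagonal g = diagonal f"
proof
  fix b
  let ?m = "fst g" and ?n = "fst f"
  obtain p where p: "\<And>j. j < ?n \<Longrightarrow> p j \<in> projections ?m"
    and g: "snd g = bcompose ?m ?n (snd f) p"
    using assms by (auto simp: preceq_V_def)
  have "p j (\<lambda>i\<in>{..<?m}. b) = b" if "j < ?n" for j
    using p[OF that] by (auto simp: projections_def projection_def const_in_cube)
  then have "(\<lambda>j\<in>{..<?n}. p j (\<lambda>i\<in>{..<?m}. b)) = (\<lambda>j\<in>{..<?n}. b)"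
    by (auto simp: fun_eq_iff)
  then show "diagonal g b = diagonal f b"
    by (simp add: diagonal_def g bcompose_def const_in_cube del: restrict_apply)
       (simp add: const_in_cube)
qed

lemma Omega1_preceq_V_closed:
  assumes "f \<in> Omega1" and "g \<preceq>\<^sub>V f"
  shows "g \<in> Omega1"
proof -
  obtain n i \<phi> where i: "i < n" and f: "f = lift_unary n i \<phi>"
    using assms(1) Omega1_iff_lift_unary by blast
  let ?m = "fst g"
  obtain p where p: "\<And>j. j < n \<Longrightarrow> p j \<in> projections ?m"
    and g: "snd g = bcompose ?m n (snd f) p"
    using assms(2) by (auto simp: preceq_V_def f lift_unary_def)
  \<comment> \<open>Since \<open>f\<close> reads only its variable \<open>i\<close>, the projection
    substituted there alone determines \<open>g\<close>.\<close>
  obtain k where k: "k < ?m" "p i = projection ?m k"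
    using p[OF i] by (auto simp: projections_def)
  \<comment> \<open>Off the cube \<open>f\<close> takes its dummy value, so this membership is what
    lets \<open>f\<close> be evaluated as \<open>\<phi>\<close> of coordinate
    \<open>i\<close>.\<close>
  have "(\<lambda>j\<in>{..<n}. p j x) \<in> cube n" for x
    by (auto simp: cube_def)
  then have "g = lift_unary ?m k \<phi>"
    using i k(2)
    by (auto simp: prod_eq_iff g f bcompose_def lift_unary_def projection_def fun_eq_iff)
  then show ?thesis
    using k(1) Omega1_iff_lift_unary by blast
qed

text \<open>Both functions apply the same unary map, \<open>f\<close> to its variable
  \<open>i\<close> and \<open>g\<close> to its variable \<open>k\<close>. Substituting the
  projection to \<open>k\<close> for every variable of \<open>f\<close> therefore yields
  \<open>g\<close>.\<close>

lemma Omega1_preceq_V_if_diagonal_eq: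
  assumes "f \<in> Omega1" and "g \<in> Omega1" and "diagonal f = diagonal g"
  shows "g \<preceq>\<^sub>V f"
proof -
  obtain n i \<phi> where i: "i < n" and f: "f = lift_unary n i \<phi>"
    using assms(1) Omega1_iff_lift_unary by blast
  obtain m k \<psi> where k: "k < m" and g: "g = lift_unary m k \<psi>"
    using assms(2) Omega1_iff_lift_unary by blast
  have eq: "\<psi> = \<phi>"
    using assms(3) i k by (simp add: f g diagonal_lift_unary)
  have "(\<lambda>j\<in>{..<n}. projection m k x) \<in> cube n" for x
    by (rule const_in_cube)
  then have "snd g = bcompose m n (snd f) (\<lambda>_. projection m k)"
    using i by (auto simp: f g eq bcompose_def lift_unary_def projection_def fun_eq_iff)
  moreover have "projection m k \<in> projections m"
    using k by (simp add: projections_def)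
  ultimately show ?thesis
    using assms(1,2) unfolding preceq_V_def Omega1_def by (auto simp: f g lift_unary_def)
qed

text \<open>The inverse sends \<open>S\<close> to the quasi-monadic functions with diagonal in
  \<open>S\<close>. This is a class because \<open>\<preceq>\<^sub>V\<close> preserves diagonals and
  stays inside \<open>Omega1\<close>. It recovers \<open>K\<close> because a class with one function
  of a given diagonal contains every quasi-monadic function with that diagonal.\<close>

lemma bij_betw_diagonal_image:
  "bij_betw (image diagonal) {K \<in> E_B. {} \<subseteq> K \<and> K \<subseteq> Omega1} UNIV"
proof (rule bij_betw_byWitness[where f' = "\<lambda>S. {f \<in> Omega1. diagonal f \<in> S}"])
  show "\<forall>K\<in>{K \<in> E_B. {} \<subseteq> K \<and> K \<subseteq> Omega1}. {f \<in> Omega1. diagonal f \<in> diagonal ` K} = K"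
  proof (safe; unfold E_B_def equational_class_def mem_Collect_eq)
    fix K f g
    assume "K \<subseteq> boolean_functions \<and> (\<forall>f g. f \<in> K \<and> g \<preceq>\<^sub>V f \<longrightarrow> g \<in> K)"
      and "K \<subseteq> Omega1" "f \<in> K" "g \<in> Omega1" "diagonal g = diagonal f"
    then show "g \<in> K"
      using Omega1_preceq_V_if_diagonal_eq by (metis subsetD)
  qed auto
  \<comment> \<open>Every unary map is the diagonal of its own lift at arity 1, so no element of
    \<open>S\<close> is lost.\<close>
  have "\<phi> \<in> diagonal ` Omega1" for \<phi>
  proof (rule image_eqI)
    show "\<phi> = diagonal (lift_unary 1 0 \<phi>)"
      by (simp add: diagonal_lift_unary)
    show "lift_unary 1 0 \<phi> \<in> Omega1"
      using Omega1_iff_lift_unary zero_less_one by blast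
  qed
  then have "diagonal ` Omega1 = UNIV"
    by blast
  moreover have "diagonal ` {f \<in> Omega1. diagonal f \<in> S} = diagonal ` Omega1 \<inter> S" for S
    by blast
  ultimately show "\<forall>S\<in>UNIV. diagonal ` {f \<in> Omega1. diagonal f \<in> S} = S"
    by simp
  show "(\<lambda>S. {f \<in> Omega1. diagonal f \<in> S}) ` UNIV \<subseteq> {K \<in> E_B. {} \<subseteq> K \<and> K \<subseteq> Omega1}"
  proof (intro image_subsetI CollectI conjI)
    fix S
    have "{f \<in> Omega1. diagonal f \<in> S} \<subseteq> boolean_functions"
      by (auto simp: Omega1_def)
    moreover have "g \<in> Omega1 \<and> diagonal g \<in> S"
      if "f \<in> Omega1" "diagonal f \<in> S" "g \<preceq>\<^sub>V f" for f g
      using that Omega1_preceq_V_closed[of f g] preceq_V_diagonal_eq[of g f] by simp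
    ultimately show "{f \<in> Omega1. diagonal f \<in> S} \<in> E_B"
      unfolding E_B_def equational_class_def by blast
  qed auto
qed simp

theorem theorem6:
  "card {K \<in> E_B. {} \<subseteq> K \<and> K \<subseteq> Omega1} = 16"
  \<comment> \<open>Here \<open>UNIV\<close> consists of all sets of maps from \<open>bool\<close>
    to \<open>bool\<close>, so its cardinality is \<open>2 ^ (2 ^ 2)\<close>.\<close>
  using bij_betw_same_card[OF bij_betw_diagonal_image] by (simp add: card_fun)

end
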